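(* Consider the event-triggered consensus protocol $$\dot{\mathbf z}(t)=\mathbf f'\big(t,\mathbf z(t),\mathbf m(\mathbf z(t))+\mathbf u(t)\big),\qquad \mathbf u_j(t)=\mathbf m_j(\mathbf z_j(\tau_t^j))-\mathbf m_j(\mathbf z_j(t)),\ j\in\mathcal V,$$ with disagreement $\mathbf x(t)=(\mathbf H\otimes\mathbf I_n)\mathbf z(t)$ and disagreement dynamics $\dot{\mathbf x}(t)=\mathbf h(t,\mathbf x(t),\mathbf u(t)):=(\mathbf H\otimes\mathbf I_n)\dot{\mathbf z}(t)$. Suppose that: (a) the functions $\{\mathbf f_i,\mathbf m_i\}_{i\in\mathcal V}$ ensure existence of solutions, for all $t\ge0$, of the protocol with continuous communication $\dot{\mathbf z}_i(t)=\mathbf f_i(t,\mathbf z_i(t),\{\mathbf m_j(\mathbf z_j(t))\}_{j\in\mathcal N_i'})$, and the disagreement dynamics are input-to-state practically stable (ISpS); (b) the functions $\mathbf f_i$ have bounded outputs and the functions $\mathbf m_i$ are differentiable, for all values of the arguments, for all $i\in\mathcal V$; (c) for every initial condition of the event-triggered protocol there exists $\bar Z>0$ such that the consensus trajectory $\bar{\mathbf z}(t)$ satisfies $\|\bar{\mathbf z}(t)\|\le\bar Z$ for all $t$ at which $\bar{\mathbf z}(t)$ exists. Let the events be generated by the NN-ETM: each agent $i\in\mathcal V$ uses $$\tau_{k+1}^i=\inf\{t>\tau_k^i:\ \|\mathbf m_i(\mathbf z_i(t))-\mathbf m_i(\mathbf z_i(\tau_k^i))\|\ge\delta(t)\}\quad\text{with}\quad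 \delta(t)=\sigma\eta_i(t)+\varepsilon,$$ where $\eta_i(t)\in[0,1]$ is the output of agent $i$'s local neural network and $\sigma\ge0$, $\varepsilon>0$ are constants. Then the solutions of the disagreement dynamics fulfill $$\|\mathbf x(t)\|\le\beta(\|\mathbf x(0)\|,t)+\gamma'(\sigma+\varepsilon)+c$$ for all $t$ at which the trajectory $\mathbf x(t)$ exists, for some $\beta\in\mathcal{KL}$, $\gamma'\in\mathcal K_\infty$ and constant $c\ge0$. Moreover, there is a minimum inter-event time $\tau>0$ such that $\tau_{k+1}^i-\tau_k^i\ge\tau$ for all $i\in\mathcal V$, $k\ge0$.
   Context: Network: $N$ agents connected by an undirected connected graph $\mathcal G=(\mathcal V,\mathcal E)$, $\mathcal V=\{1,\dots,N\}$; $\mathcal N_i$ is the neighbor set of agent $i$ and $\mathcal N_i'=\mathcal N_i\cup\{i\}$. $\|\cdot\|$ is the Euclidean norm, $\mathbf I_n$ the identity, $\mathds{1}_N$ the all-ones vector, $\otimes$ the Kronecker product. Protocol: agent $i$ has state $\mathbf z_i(t)\in\mathbb R^n$ and output message function $\mathbf m_i$. With continuous communication, $\dot{\mathbf z}_i(t)=\mathbf f_i(t,\mathbf z_i(t),\{\mathbf m_j(\mathbf z_j(t))\}_{j\in\mathcal N_i'})$. With event-triggered communication, agent $j$ transmits only at its event instants $\tau_0^j<\tau_1^j<\dots$, and $\dot{\mathbf z}_i(t)=\mathbf f_i(t,\mathbf z_i(t),\{\mathbf m_j(\mathbf z_j(\tau_t^j))\}_{j\in\mathcal N_i'})$, where $\tau_t^j=\max\{\tau_k^j:\tau_k^j\le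 t\}$ is the last event of agent $j$ up to time $t$ (with $\tau_0^j=0$). Stack $\mathbf z=[\mathbf z_1^\top,\dots,\mathbf z_N^\top]^\top$, $\mathbf m(\mathbf z)=[\mathbf m_1(\mathbf z_1)^\top,\dots,\mathbf m_N(\mathbf z_N)^\top]^\top$, $\mathbf u=[\mathbf u_1^\top,\dots,\mathbf u_N^\top]^\top$; $\mathbf f'$ is the stacked vector field, so that the continuous-communication protocol is $\dot{\mathbf z}=\mathbf f'(t,\mathbf z,\mathbf m(\mathbf z))$. Disagreement: $\mathbf H=\mathbf I_N-(1/N)\mathds{1}_N\mathds{1}_N^\top$, and $\mathbf z(t)=(\mathds{1}_N\otimes\mathbf I_n)\bar{\mathbf z}(t)+\mathbf x(t)$ with consensus trajectory $\bar{\mathbf z}(t)=(1/N)\sum_i\mathbf z_i(t)$. The only property of the neural network output $\eta_i(t)$ that is imposed is that it takes values in $[0,1]$ for all $t$. The minimum inter-event time $\tau$ may depend on the trajectory. ISpS: a system $\dot{\mathbf x}=\mathbf h(t,\mathbf x,\mathbf u)$ is ISpS if there exist a class $\mathcal{KL}$ function $\beta$, a class $\mathcal K_\infty$ function $\gamma$ and a constant $c$ such that for any initial state $\mathbf x(0)$ and bounded input $\mathbf u$, the solution satisfies $\|\mathbf x(t)\|\le\beta(\|\mathbf x(0)\|,t)+\gamma\big(\sup_{s\in[0,t]}\|\mathbf u(s)\|\big)+c$. ($\mathcal K_\infty$: continuous, strictly increasing, unbounded functions $[0,\infty)\to[0,\infty)$ vanishing at $0$. $\mathcal{KL}$: continuous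 $\beta(r,t)$ that, for fixed $t$, is strictly increasing in $r$ and zero at $r=0$, and for fixed $r$ is decreasing in $t$ with limit $0$.) *)

theory Defs
  imports "HOL-Analysis.Analysis"
begin

text \<open>Agents are the elements of a finite type \<^typ>\<open>'v\<close>, so that the number of agents is its cardinality.
  A stacked vector, with one block per agent, has type \<^typ>\<open>real ^ 'n ^ 'v\<close>; the norm of this type
  is the Euclidean norm of the stacked vector.\<close>

definition undirected_connected :: "('v \<Rightarrow> 'v \<Rightarrow> bool) \<Rightarrow> bool" where
  "undirected_connected E \<longleftrightarrow> symp E \<and> irreflp E \<and> (\<forall>i j. rtranclp E i j)"

definition closed_nbhd :: "('v \<Rightarrow> 'v \<Rightarrow> bool) \<Rightarrow> 'v \<Rightarrow> 'v set" where
  "closed_nbhd E i = insert i {j. E i j}"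

text \<open>The messages reach agent \<open>i\<close> as a family restricted to its closed neighborhood, so \<open>f i\<close>
  cannot depend on the messages of any other agent.\<close>

definition stacked_field ::
  "('v \<Rightarrow> 'v \<Rightarrow> bool) \<Rightarrow> ('v \<Rightarrow> real \<Rightarrow> real^'n \<Rightarrow> ('v \<Rightarrow> real^'p) \<Rightarrow> real^'n)
    \<Rightarrow> real \<Rightarrow> real^'n^'v \<Rightarrow> real^'p^'v \<Rightarrow> real^'n^'v" where
  "stacked_field E f t z w = (\<chi> i. f i t (z $ i) (\<lambda>j\<in>closed_nbhd E i. w $ j))"

definition stacked_message ::
  "('v \<Rightarrow> real^'n \<Rightarrow> real^'p) \<Rightarrow> real^'n^'v \<Rightarrow> real^'p^'v" where
  "stacked_message m z = (\<chi> i. m i (z $ i))"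

definition centering :: "real^'v^'v" where
  "centering = mat 1 - (\<chi> i j. 1 / real CARD('v))"

text \<open>A stacked vector is also the matrix whose rows are the blocks. Multiplying this matrix by \<open>centering\<close>
  from the left is the action of the Kronecker product of \<open>centering\<close> and the identity matrix
  on the stacked vector.\<close>

definition disagreement :: "real^'n^'v \<Rightarrow> real^'n^'v" where
  "disagreement z = centering ** z"

definition consensus :: "real^'n^'v \<Rightarrow> real^'n" where
  "consensus z = (1 / real CARD('v)) *\<^sub>R (\<Sum>i\<in>UNIV. z $ i)"

lemma consensus_plus_disagreement: "z $ i = consensus z + disagreement z $ i"
proof -
  have "disagreement z $ i $ k = z $ i $ k - consensus z $ k" for k
    by (simp add: disagreement_def consensus_def centering_def matrix_matrix_mult_def mat_def
        left_diff_distrib sum_subtractf if_distrib [where f = "\<lambda>a. a * _"] sum_distrib_left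
        cong: if_cong)
  then show ?thesis
    by (simp add: vec_eq_iff)
qed

text \<open>A trajectory need not exist for all times; it lives on an interval of times that starts
  at \<open>0\<close>, and solutions are meant in the sense of Caratheodory.\<close>

definition time_domain :: "real set \<Rightarrow> bool" where
  "time_domain J \<longleftrightarrow> is_interval J \<and> 0 \<in> J \<and> J \<subseteq> {0..}"

definition solves :: "(real \<Rightarrow> 'a \<Rightarrow> 'a) \<Rightarrow> real set \<Rightarrow> (real \<Rightarrow> 'a::euclidean_space) \<Rightarrow> bool" where
  "solves F J z \<longleftrightarrow> (\<forall>t\<in>J. (\<lambda>s. F s (z s)) absolutely_integrable_on {0..t} \<and>
                            z t = z 0 + integral {0..t} (\<lambda>s. F s (z s)))"

definition class_K_inf :: "(real \<Rightarrow> real) \<Rightarrow> bool" where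
  "class_K_inf \<gamma> \<longleftrightarrow> continuous_on {0..} \<gamma> \<and> strict_mono_on {0..} \<gamma> \<and> \<gamma> 0 = 0 \<and>
     filterlim \<gamma> at_top at_top"

definition class_KL :: "(real \<Rightarrow> real \<Rightarrow> real) \<Rightarrow> bool" where
  "class_KL \<beta> \<longleftrightarrow> continuous_on ({0..} \<times> {0..}) (\<lambda>(r, t). \<beta> r t) \<and>
     (\<forall>t\<ge>0. strict_mono_on {0..} (\<lambda>r. \<beta> r t) \<and> \<beta> 0 t = 0) \<and>
     (\<forall>r\<ge>0. antimono_on {0..} (\<beta> r) \<and> (\<beta> r \<longlongrightarrow> 0) at_top)"

text \<open>A system is given by its trajectories, each with its time domain and its input. The right-hand
  side of the disagreement dynamics depends not only on the disagreement but also on the consensus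
  trajectory, so it is not a function of time, disagreement and input alone.\<close>

definition ISpS ::
  "(real set \<times> (real \<Rightarrow> 'x::real_normed_vector) \<times> (real \<Rightarrow> 'u::real_normed_vector)) set \<Rightarrow> bool" where
  "ISpS S \<longleftrightarrow> (\<exists>\<beta> \<gamma> c. class_KL \<beta> \<and> class_K_inf \<gamma> \<and>
     (\<forall>(J, x, u) \<in> S. bounded (u ` J) \<longrightarrow>
        (\<forall>t\<in>J. norm (x t) \<le> \<beta> (norm (x 0)) t + \<gamma> (SUP s\<in>{0..t}. norm (u s)) + c)))"

definition disagreement_system ::
  "('v \<Rightarrow> 'v \<Rightarrow> bool) \<Rightarrow> ('v \<Rightarrow> real \<Rightarrow> real^'n \<Rightarrow> ('v \<Rightarrow> real^'p) \<Rightarrow> real^'n)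
    \<Rightarrow> ('v \<Rightarrow> real^'n \<Rightarrow> real^'p)
    \<Rightarrow> (real set \<times> (real \<Rightarrow> real^'n^'v) \<times> (real \<Rightarrow> real^'p^'v)) set" where
  "disagreement_system E f m = {(J, \<lambda>t. disagreement (z t), u) | J z u. time_domain J \<and>
     solves (\<lambda>t \<zeta>. stacked_field E f t \<zeta> (stacked_message m \<zeta> + u t)) J z}"

text \<open>The events of one agent with threshold \<open>\<delta>\<close>, where \<open>g\<close> is its message as a function of time.
  If the triggering condition is never met again, the next event time is \<open>\<infinity>\<close>, and so are all
  later ones.\<close>

primrec event_time :: "(real \<Rightarrow> real) \<Rightarrow> real set \<Rightarrow> (real \<Rightarrow> 'a::real_normed_vector) \<Rightarrow> nat \<Rightarrow> ereal" where
  "event_time \<delta> J g 0 = 0"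
| "event_time \<delta> J g (Suc k) =
     Inf {ereal t | t. t \<in> J \<and> event_time \<delta> J g k < ereal t \<and>
                       norm (g t - g (real_of_ereal (event_time \<delta> J g k))) \<ge> \<delta> t}"

text \<open>The set below is finite unless the events accumulate before \<open>t\<close>. No assumption excludes this;
  it cannot happen along a solution when the vector field is bounded, the message functions are
  continuous and the thresholds are bounded away from \<open>0\<close>.\<close>

definition last_event :: "(nat \<Rightarrow> ereal) \<Rightarrow> real \<Rightarrow> real" where
  "last_event \<tau> t = real_of_ereal (Max {\<tau> k | k. \<tau> k \<le> ereal t})"

definition transmission_error ::
  "('v \<Rightarrow> real^'n \<Rightarrow> real^'p) \<Rightarrow> ('v \<Rightarrow> nat \<Rightarrow> ereal) \<Rightarrow> (real \<Rightarrow> real^'n^'v) \<Rightarrow> real \<Rightarrow> real^'p^'v" where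
  "transmission_error m \<tau> z t = (\<chi> j. m j (z (last_event (\<tau> j) t) $ j) - m j (z t $ j))"

text \<open>\<open>\<eta> i z t\<close> is the output at time \<open>t\<close> of the neural network of agent \<open>i\<close> along the trajectory \<open>z\<close>.\<close>

definition nn_etm_events ::
  "('v \<Rightarrow> real^'n \<Rightarrow> real^'p) \<Rightarrow> real \<Rightarrow> real \<Rightarrow> ('v \<Rightarrow> (real \<Rightarrow> real^'n^'v) \<Rightarrow> real \<Rightarrow> real)
    \<Rightarrow> real set \<Rightarrow> (real \<Rightarrow> real^'n^'v) \<Rightarrow> 'v \<Rightarrow> nat \<Rightarrow> ereal" where
  "nn_etm_events m \<sigma> \<epsilon> \<eta> J z i =
     event_time (\<lambda>t. \<sigma> * \<eta> i z t + \<epsilon>) J (\<lambda>t. m i (z t $ i))"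

definition nn_etm_solution ::
  "('v \<Rightarrow> 'v \<Rightarrow> bool) \<Rightarrow> ('v \<Rightarrow> real \<Rightarrow> real^'n \<Rightarrow> ('v \<Rightarrow> real^'p) \<Rightarrow> real^'n)
    \<Rightarrow> ('v \<Rightarrow> real^'n \<Rightarrow> real^'p) \<Rightarrow> real \<Rightarrow> real
    \<Rightarrow> ('v \<Rightarrow> (real \<Rightarrow> real^'n^'v) \<Rightarrow> real \<Rightarrow> real) \<Rightarrow> real set \<Rightarrow> (real \<Rightarrow> real^'n^'v) \<Rightarrow> bool" where
  "nn_etm_solution E f m \<sigma> \<epsilon> \<eta> J z \<longleftrightarrow> time_domain J \<and>
     solves (\<lambda>t \<zeta>. stacked_field E f t \<zeta>
       (stacked_message m \<zeta> + transmission_error m (nn_etm_events m \<sigma> \<epsilon> \<eta> J z) z t)) J z"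

end

theory Submission
  imports Defs
begin

text \<open>Between two events the transmission error of an agent stays below its threshold, provided that
  its events do not accumulate. The vector field is bounded, so trajectories are Lipschitz in time,
  and on a bounded time interval the trajectory is bounded. On a bounded set the messages are uniformly
  continuous; hence so is the message as a function of time, and events, across which it changes by at
  least \<open>\<epsilon>\<close>, are separated. The transmission error is therefore bounded by a multiple of \<open>\<sigma> + \<epsilon>\<close>, and
  ISpS bounds the disagreement. Together with the bound on the consensus trajectory this bounds the
  whole trajectory, and the same uniform continuity argument, now without a restriction of the time,
  yields a minimum inter-event time.\<close>

section \<open>Regularity along trajectories\<close>

text \<open>An increment of the trajectory is the integral of the field over the time in between,
  hence at most \<open>B\<close> times its length.\<close>

lemma solves_lipschitz_on:
  assumes J: "time_domain J" and z: "solves F J z"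
    and B: "\<And>t x. t \<ge> 0 \<Longrightarrow> norm (F t x) \<le> B"
  shows "B-lipschitz_on J z"
proof -
  have "0 \<le> B"
    using B [of 0 undefined] norm_ge_zero order_trans by blast
  have le: "dist (z t) (z s) \<le> B * dist t s" if s: "s \<in> J" and t: "t \<in> J" and "s \<le> t" for s t
  proof -
    define h where "h = (\<lambda>r. F r (z r))"
    have "0 \<le> s"
      using J s by (auto simp: time_domain_def)
    have h: "h integrable_on {0..t}"
      using z t by (auto simp: solves_def h_def set_lebesgue_integral_eq_integral)
    have "integral {0..s} h + integral {s..t} h = integral {0..t} h"
      by (rule Henstock_Kurzweil_Integration.integral_combine) (use \<open>0 \<le> s\<close> \<open>s \<le> t\<close> h in auto)
    moreover have "z t = z 0 + integral {0..t} h" "z s = z 0 + integral {0..s} h"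
      using z s t by (auto simp: solves_def h_def)
    ultimately have eq: "z t - z s = integral {s..t} h"
      by (simp add: algebra_simps)
    have "h integrable_on {s..t}"
      using h by (rule integrable_on_subinterval) (use \<open>0 \<le> s\<close> in auto)
    then have "norm (integral {s..t} h) \<le> B * measure lborel {s..t}"
      by (intro has_integral_bound_real [where S = "{}" and f = h] \<open>0 \<le> B\<close> integrable_integral)
        (use B \<open>0 \<le> s\<close> in \<open>auto simp: h_def\<close>)
    then show ?thesis
      using eq \<open>s \<le> t\<close> by (simp add: dist_norm)
  qed
  show ?thesis
    by (rule lipschitz_onI) (metis le dist_commute linear, fact)
qed

text \<open>By Heine-Borel the closure of the bounded image is compact, so \<open>\<phi>\<close> is
  uniformly continuous there. It serves for messages, which are continuous but need not be globally
  Lipschitz.\<close>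

lemma uniformly_continuous_on_bounded_compose:
  fixes y :: "'a::metric_space \<Rightarrow> 'b::heine_borel" and \<phi> :: "'b \<Rightarrow> 'c::metric_space"
  assumes y: "uniformly_continuous_on S y" and "bounded (y ` S)" and \<phi>: "continuous_on UNIV \<phi>"
  shows "uniformly_continuous_on S (\<lambda>t. \<phi> (y t))"
proof -
  have "uniformly_continuous_on (closure (y ` S)) \<phi>"
    using assms by (intro compact_uniformly_continuous) (auto intro: continuous_on_subset)
  then have "uniformly_continuous_on (y ` S) \<phi>"
    unfolding uniformly_continuous_on_def using closure_subset by (meson subsetD)
  with y show ?thesis
    by (rule uniformly_continuous_on_compose)
qed

section \<open>Event times and their separation\<close>

text \<open>A finite infimum lies between the previous event and some triggering time, both in the
  interval \<open>J\<close>. So trajectories are evaluated at events only inside their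
  domain.\<close>

lemma event_time_cases:
  assumes J: "time_domain J"
  obtains "event_time \<delta> J g k = \<infinity>" | t where "t \<in> J" "event_time \<delta> J g k = ereal t"
proof -
  have "event_time \<delta> J g k = \<infinity> \<or> (\<exists>t\<in>J. event_time \<delta> J g k = ereal t)"
  proof (induction k)
    case 0
    then show ?case
      using J by (auto simp: time_domain_def zero_ereal_def)
  next
    case (Suc k)
    define A where "A = {ereal t | t. t \<in> J \<and> event_time \<delta> J g k < ereal t \<and>
                       norm (g t - g (real_of_ereal (event_time \<delta> J g k))) \<ge> \<delta> t}"
    have A: "event_time \<delta> J g (Suc k) = Inf A"
      by (simp add: A_def)
    show ?case
    proof (cases "A = {}")
      case True
      then have "event_time \<delta> J g (Suc k) = \<infinity>"
        unfolding A by (simp add: top_ereal_def)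
      then show ?thesis ..
    next
      case False
      \<comment> \<open>A triggering time lies beyond the previous event, which is therefore
        finite.\<close>
      then obtain t where t: "t \<in> J" "event_time \<delta> J g k < ereal t" "ereal t \<in> A"
        by (auto simp: A_def)
      then obtain s where s: "s \<in> J" "event_time \<delta> J g k = ereal s"
        using Suc by auto
      have "ereal s \<le> Inf A"
        by (rule Inf_greatest) (auto simp: A_def s)
      moreover have "Inf A \<le> ereal t"
        using t by (simp add: Inf_lower)
      ultimately obtain r where r: "Inf A = ereal r" "s \<le> r" "r \<le> t"
        by (cases "Inf A") auto
      then have "r \<in> J"
        using J s t unfolding time_domain_def is_interval_1 by blast
      then show ?thesis
        using r A by auto
    qed
  qed
  then show ?thesis
    using that by blast
qed

text \<open>At a triggering time up to \<open>T\<close> the message differs by at least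
  \<open>\<epsilon>\<close> from its value at the last event, so uniform continuity keeps the two
  times \<open>d\<close> apart, with \<open>d\<close> independent of \<open>k\<close>; the infimum
  inherits this. The horizon \<open>T\<close> allows uniform continuity on an initial stretch of
  \<open>J\<close> only, while \<open>T = \<infinity>\<close> covers all of
  \<open>J\<close>.\<close>

lemma event_time_gap:
  fixes T :: ereal
  assumes J: "time_domain J" and \<delta>: "\<And>t. \<epsilon> \<le> \<delta> t" and "\<epsilon> > 0"
    and g: "uniformly_continuous_on {t \<in> J. ereal t \<le> T} g"
  obtains d where "d > 0"
    "\<And>k. min T (event_time \<delta> J g k + ereal d) \<le> event_time \<delta> J g (Suc k)"
proof -
  obtain d where "d > 0" and d: "\<forall>s\<in>{t \<in> J. ereal t \<le> T}. \<forall>t\<in>{t \<in> J. ereal t \<le> T}.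
      dist t s < d \<longrightarrow> dist (g t) (g s) < \<epsilon>"
    using g [unfolded uniformly_continuous_on_def, rule_format, OF \<open>\<epsilon> > 0\<close>] by blast
  have "min T (event_time \<delta> J g k + ereal d) \<le> event_time \<delta> J g (Suc k)" for k
  proof -
    have "min T (event_time \<delta> J g k + ereal d) \<le> ereal t"
      if t: "t \<in> J" "event_time \<delta> J g k < ereal t"
        "norm (g t - g (real_of_ereal (event_time \<delta> J g k))) \<ge> \<delta> t" for t
    proof (cases "ereal t \<le> T")
      case True
      obtain s where s: "s \<in> J" "event_time \<delta> J g k = ereal s"
        using J t by (cases rule: event_time_cases [of J \<delta> g k]) auto
      have "\<epsilon> \<le> dist (g t) (g s)"
        using t s \<delta> [of t] by (simp add: dist_norm)
      moreover have "ereal s \<le> T"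
        using True t s by (metis order.strict_implies_order order_trans)
      ultimately have "\<not> dist t s < d"
        using d s t True by (auto simp: not_less [symmetric])
      then have "s + d \<le> t"
        using t s by (simp add: dist_real_def)
      then show ?thesis
        by (simp add: s min.coboundedI2)
    qed (simp add: min.coboundedI1)
    then show ?thesis
      by (auto intro!: Inf_greatest)
  qed
  with \<open>d > 0\<close> that show thesis
    by blast
qed

text \<open>Separated events are finite in number up to \<open>t\<close>, so the last one is a true
  maximum and the next comes after \<open>t\<close>. Hence the triggering condition fails at
  \<open>t\<close>, unless \<open>t\<close> is itself an event.\<close>

lemma norm_last_event_le:
  assumes J: "time_domain J" and \<delta>: "\<And>t. \<epsilon> \<le> \<delta> t" and "\<epsilon> > 0" and t: "t \<in> J"
    and g: "uniformly_continuous_on {s \<in> J. s \<le> t + 1} g"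
  shows "norm (g (last_event (event_time \<delta> J g) t) - g t) \<le> \<delta> t"
proof -
  define e where "e = event_time \<delta> J g"
  have "0 \<le> t"
    using J t by (auto simp: time_domain_def)
  \<comment> \<open>The horizon must exceed \<open>t\<close> strictly: an event up to
    \<open>t\<close> is then below the horizon, and its successor is strictly later.\<close>
  obtain d where "d > 0" and d: "\<And>k. min (ereal (t + 1)) (e k + ereal d) \<le> e (Suc k)"
    unfolding e_def
    using event_time_gap [where \<delta> = \<delta>, OF J \<delta> \<open>\<epsilon> > 0\<close>, of "ereal (t + 1)" g] g
    unfolding ereal_less_eq by blast
  have e_lower: "min (ereal (t + 1)) (ereal (real k * d)) \<le> e k" for k
  proof (induction k)
    case 0
    then show ?case
      using \<open>0 \<le> t\<close> by (simp add: e_def flip: zero_ereal_def)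
  next
    case (Suc k)
    have "min (ereal (t + 1)) (ereal (real (Suc k) * d)) \<le> min (ereal (t + 1)) (e k + ereal d)"
      using Suc \<open>d > 0\<close> by (cases "e k") (auto simp: min_def algebra_simps split: if_splits)
    with d [of k] show ?case
      by (rule order_trans [rotated])
  qed
  \<comment> \<open>This yields finiteness of the set in \<open>last_event\<close>; on an infinite
    set \<open>Max\<close> would be unspecified.\<close>
  have "k \<le> nat \<lceil>t / d\<rceil>" if "e k \<le> ereal t" for k
  proof -
    have "min (ereal (t + 1)) (ereal (real k * d)) \<le> ereal t"
      using e_lower that by (rule order_trans)
    then have "real k * d \<le> t"
      by (auto simp: min_def split: if_splits)
    then have "real k \<le> t / d"
      using \<open>d > 0\<close> by (simp add: field_simps)
    then show ?thesis
      by linarith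
  qed
  then have "{k. e k \<le> ereal t} \<subseteq> {..nat \<lceil>t / d\<rceil>}"
    by auto
  then have "finite {k. e k \<le> ereal t}"
    by (rule finite_subset) simp
  then have fin: "finite {e k | k. e k \<le> ereal t}"
    by simp
  have "e 0 \<le> ereal t"
    using \<open>0 \<le> t\<close> by (simp add: e_def)
  then have "Max {e k | k. e k \<le> ereal t} \<in> {e k | k. e k \<le> ereal t}"
    by (intro Max_in [OF fin]) auto
  then obtain k where k: "e k \<le> ereal t" "Max {e k | k. e k \<le> ereal t} = e k"
    by auto
  obtain s where s: "s \<in> J" "e k = ereal s"
    using J k(1) by (cases rule: event_time_cases [of J \<delta> g k]) (auto simp: e_def)
  have last: "last_event e t = s"
    by (simp add: last_event_def k s)
  have "e k < e (Suc k)"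
    using d [of k] k(1) \<open>d > 0\<close> s by (cases "e (Suc k)") (auto simp: min_def split: if_splits)
  \<comment> \<open>A successor up to \<open>t\<close> would belong to the set whose maximum is
    \<open>e k\<close>.\<close>
  moreover have "e (Suc k) \<le> e k" if "e (Suc k) \<le> ereal t"
    using Max_ge [OF fin, of "e (Suc k)"] that k(2) by auto
  ultimately have next_event: "ereal t < e (Suc k)"
    by (meson not_le)
  show ?thesis
  \<comment> \<open>The infimum defining \<open>e (Suc k)\<close> ranges over times strictly after
    \<open>s\<close>, so \<open>s = t\<close> is treated apart; the error then vanishes.\<close>
  proof (cases "s = t")
    case True
    then show ?thesis
      using last \<delta> [of t] \<open>\<epsilon> > 0\<close> by (simp add: e_def)
  next
    case False
    then have "s < t"
      using k s by simp
    have "\<not> \<delta> t \<le> norm (g t - g s)"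
    proof
      assume "\<delta> t \<le> norm (g t - g s)"
      then have "e (Suc k) \<le> ereal t"
        using s t \<open>s < t\<close> by (auto simp: e_def intro!: Inf_lower)
      with next_event show False
        by simp
    qed
    then show ?thesis
      using last by (simp add: e_def norm_minus_commute)
  qed
qed

section \<open>Block norms and comparison functions\<close>

lemma norm_vec_le_card:
  fixes x :: "'a::real_normed_vector ^ 'v"
  assumes "\<And>i. norm (x $ i) \<le> b"
  shows "norm x \<le> real CARD('v) * b"
proof -
  have "norm x \<le> (\<Sum>i\<in>UNIV. norm (x $ i))"
    by (simp add: norm_vec_def L2_set_le_sum)
  also have "\<dots> \<le> real CARD('v) * b"
    using assms by (rule sum_bounded_above)
  finally show ?thesis .
qed

text \<open>Absorbs the number of agents, a factor in the bound on the stacked error, into the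
  gain.\<close>

lemma class_K_inf_scale:
  assumes \<gamma>: "class_K_inf \<gamma>" and "a > 0"
  shows "class_K_inf (\<lambda>s. \<gamma> (a * s))"
proof -
  have "continuous_on {0..} (\<lambda>s. \<gamma> (a * s))"
    by (rule continuous_on_compose2 [where g = \<gamma> and t = "{0..}"])
      (use assms in \<open>auto simp: class_K_inf_def intro: continuous_on_mult_left\<close>)
  moreover have "strict_mono_on {0..} (\<lambda>s. \<gamma> (a * s))"
    using assms by (auto simp: class_K_inf_def strict_mono_on_def)
  moreover have "filterlim (\<lambda>s. \<gamma> (a * s)) at_top at_top"
  proof (rule filterlim_compose [of \<gamma>])
    show "filterlim \<gamma> at_top at_top"
      using \<gamma> by (simp add: class_K_inf_def)
    show "filterlim (\<lambda>s. a * s) at_top at_top"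
      using tendsto_const \<open>a > 0\<close> filterlim_ident by (rule filterlim_tendsto_pos_mult_at_top)
  qed
  ultimately show ?thesis
    using \<gamma> by (simp add: class_K_inf_def)
qed

section \<open>Disagreement bound and minimum inter-event time\<close>

text \<open>\<open>\<beta>\<close>, \<open>\<gamma>'\<close> and \<open>c\<close> are chosen before
  \<open>\<sigma>\<close>, \<open>\<epsilon>\<close> and \<open>\<eta>\<close>. The bound on the
  consensus concerns event-triggered solutions and so stands in the scope of these parameters. If no
  further event occurs, the gap inequality holds trivially, its right side being
  \<open>\<infinity>\<close>.\<close>

theorem corollary1:
  fixes E :: "'v::finite \<Rightarrow> 'v \<Rightarrow> bool"
    and f :: "'v \<Rightarrow> real \<Rightarrow> real^'n \<Rightarrow> ('v \<Rightarrow> real^'p) \<Rightarrow> real^'n"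
    and m :: "'v \<Rightarrow> real^'n \<Rightarrow> real^'p"
  assumes graph: "undirected_connected E"
    and existence: "\<forall>z0. \<exists>z. z 0 = z0 \<and>
          solves (\<lambda>t \<zeta>. stacked_field E f t \<zeta> (stacked_message m \<zeta>)) {0..} z"
    and isps: "ISpS (disagreement_system E f m)"
    and bounded_f: "\<forall>i. \<exists>B. \<forall>t\<ge>0. \<forall>\<zeta> w. norm (f i t \<zeta> (\<lambda>j\<in>closed_nbhd E i. w j)) \<le> B"
    and differentiable_m: "\<forall>i \<zeta>. m i differentiable (at \<zeta>)"
  shows "\<exists>\<beta> \<gamma>' c. class_KL \<beta> \<and> class_K_inf \<gamma>' \<and> c \<ge> 0 \<and>
    (\<forall>\<sigma> \<epsilon> \<eta>. \<sigma> \<ge> 0 \<longrightarrow> \<epsilon> > 0 \<longrightarrow> (\<forall>i z t. \<eta> i z t \<in> {0..1}) \<longrightarrow>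
      (\<forall>J z. nn_etm_solution E f m \<sigma> \<epsilon> \<eta> J z \<longrightarrow>
         (\<exists>Z>0. \<forall>t\<in>J. norm (consensus (z t)) \<le> Z)) \<longrightarrow>
      (\<forall>J z. nn_etm_solution E f m \<sigma> \<epsilon> \<eta> J z \<longrightarrow>
         (\<forall>t\<in>J. norm (disagreement (z t))
            \<le> \<beta> (norm (disagreement (z 0))) t + \<gamma>' (\<sigma> + \<epsilon>) + c) \<and>
         (\<exists>\<tau>>0. \<forall>i k. nn_etm_events m \<sigma> \<epsilon> \<eta> J z i k + ereal \<tau>
            \<le> nn_etm_events m \<sigma> \<epsilon> \<eta> J z i (Suc k))))"
proof -
  obtain \<beta> \<gamma> c where \<beta>: "class_KL \<beta>" and \<gamma>: "class_K_inf \<gamma>"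
    and bound: "\<And>J x u t. (J, x, u) \<in> disagreement_system E f m \<Longrightarrow> bounded (u ` J) \<Longrightarrow> t \<in> J \<Longrightarrow>
      norm (x t) \<le> \<beta> (norm (x 0)) t + \<gamma> (SUP s\<in>{0..t}. norm (u s)) + c"
    using isps unfolding ISpS_def by fast
  define N where "N = real CARD('v)"
  have "N > 0"
    by (simp add: N_def)
  obtain Bi where Bi: "\<And>i t \<zeta> w. t \<ge> 0 \<Longrightarrow> norm (f i t \<zeta> (\<lambda>j\<in>closed_nbhd E i. w j)) \<le> Bi i"
    using bounded_f by metis
  define B where "B = N * Max (range Bi)"
  have field: "norm (stacked_field E f t \<zeta> w) \<le> B" if "t \<ge> 0" for t \<zeta> w
    unfolding B_def N_def
  proof (rule norm_vec_le_card)
    show "norm (stacked_field E f t \<zeta> w $ i) \<le> Max (range Bi)" for i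
      using order_trans [OF Bi [OF that, of i "\<zeta> $ i" "($) w"] Max_ge [of "range Bi"]]
      by (simp add: stacked_field_def)
  qed
  have m_cont: "continuous_on UNIV (\<lambda>\<zeta>::real^'n^'v. m i (\<zeta> $ i))" for i
  proof (rule continuous_on_compose2 [of UNIV "m i"])
    show "continuous_on UNIV (m i)"
      using differentiable_m
      by (blast intro: continuous_at_imp_continuous_on differentiable_imp_continuous_within)
    show "continuous_on UNIV (\<lambda>\<zeta>::real^'n^'v. \<zeta> $ i)"
      by (rule continuous_on_component) (rule continuous_on_id)
  qed simp
  \<comment> \<open>\<open>N * (\<sigma> + \<epsilon>)\<close> bounds the stacked transmission
    error; \<open>\<bar>c\<bar>\<close> appears because ISpS leaves the sign of \<open>c\<close>
    open.\<close>
  have main: "(\<forall>t\<in>J. norm (disagreement (z t))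
            \<le> \<beta> (norm (disagreement (z 0))) t + \<gamma> (N * (\<sigma> + \<epsilon>)) + \<bar>c\<bar>) \<and>
         (\<exists>\<tau>>0. \<forall>i k. nn_etm_events m \<sigma> \<epsilon> \<eta> J z i k + ereal \<tau>
            \<le> nn_etm_events m \<sigma> \<epsilon> \<eta> J z i (Suc k))"
    if "\<sigma> \<ge> 0" and "\<epsilon> > 0" and \<eta>: "\<And>i z t. \<eta> i z t \<in> {0..1}"
      and sol: "nn_etm_solution E f m \<sigma> \<epsilon> \<eta> J z"
      and Z: "\<And>t. t \<in> J \<Longrightarrow> norm (consensus (z t)) \<le> Z"
    for \<sigma> \<epsilon> \<eta> J z Z
  proof
    define \<delta> where "\<delta> = (\<lambda>i t. \<sigma> * \<eta> i z t + \<epsilon>)"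
    define g where "g = (\<lambda>i t. m i (z t $ i))"
    \<comment> \<open>Along a fixed trajectory the error is a function of time alone, so
      \<open>z\<close> solves the protocol with external input \<open>u\<close> and ISpS
      applies.\<close>
    define u where "u = transmission_error m (nn_etm_events m \<sigma> \<epsilon> \<eta> J z) z"
    have events: "nn_etm_events m \<sigma> \<epsilon> \<eta> J z i = event_time (\<delta> i) J (g i)" for i
      by (simp add: nn_etm_events_def \<delta>_def g_def)
    have \<delta>_ge: "\<epsilon> \<le> \<delta> i t" and \<delta>_le: "\<delta> i t \<le> \<sigma> + \<epsilon>" for i t
      using \<eta> [of i z t] \<open>\<sigma> \<ge> 0\<close> by (auto simp: \<delta>_def mult_left_le)
    have J: "time_domain J" and
      z: "solves (\<lambda>t \<zeta>. stacked_field E f t \<zeta> (stacked_message m \<zeta> + u t)) J z"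
      using sol by (auto simp: nn_etm_solution_def u_def)
    have lip: "B-lipschitz_on J z"
      using J z by (rule solves_lipschitz_on) (rule field)
    have g_uc: "uniformly_continuous_on S (g i)" if "S \<subseteq> J" "bounded (z ` S)" for S i
      unfolding g_def
      by (rule uniformly_continuous_on_bounded_compose [OF _ that(2) m_cont])
        (rule lipschitz_on_uniformly_continuous [OF lipschitz_on_subset [OF lip that(1)]])
    \<comment> \<open>No global bound on \<open>z\<close> is available yet, since it will rest on
      this estimate; boundedness up to time \<open>t + 1\<close> comes from the Lipschitz
      property.\<close>
    have u_le: "norm (u t) \<le> N * (\<sigma> + \<epsilon>)" if t: "t \<in> J" for t
      unfolding N_def
    proof (rule norm_vec_le_card)
      fix i
      have "{s \<in> J. s \<le> t + 1} \<subseteq> cball 0 (t + 1)"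
        using J by (auto simp: time_domain_def)
      then have "bounded {s \<in> J. s \<le> t + 1}"
        by (rule bounded_subset [OF bounded_cball])
      moreover have "uniformly_continuous_on {s \<in> J. s \<le> t + 1} z"
        by (rule lipschitz_on_uniformly_continuous [OF lipschitz_on_subset [OF lip]]) simp
      ultimately have "bounded (z ` {s \<in> J. s \<le> t + 1})"
        using bounded_uniformly_continuous_image by blast
      then have "uniformly_continuous_on {s \<in> J. s \<le> t + 1} (g i)"
        by (intro g_uc) simp
      then have "norm (g i (last_event (event_time (\<delta> i) J (g i)) t) - g i t) \<le> \<delta> i t"
        by (rule norm_last_event_le [where \<delta> = "\<delta> i", OF J \<delta>_ge \<open>\<epsilon> > 0\<close> t])
      then show "norm (u t $ i) \<le> \<sigma> + \<epsilon>"
        using \<delta>_le [of i t] by (simp add: u_def transmission_error_def events flip: g_def)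
          (simp add: g_def)
    qed
    show x_le: "\<forall>t\<in>J. norm (disagreement (z t))
            \<le> \<beta> (norm (disagreement (z 0))) t + \<gamma> (N * (\<sigma> + \<epsilon>)) + \<bar>c\<bar>"
    proof
      fix t assume t: "t \<in> J"
      have sub: "{0..t} \<subseteq> J"
        using J t unfolding time_domain_def is_interval_1 by fastforce
      have "0 \<le> t"
        using J t by (auto simp: time_domain_def)
      have "bounded (u ` J)"
        using u_le by (auto simp: bounded_iff)
      moreover have "(J, \<lambda>t. disagreement (z t), u) \<in> disagreement_system E f m"
        using J z by (auto simp: disagreement_system_def)
      ultimately have "norm (disagreement (z t)) \<le> \<beta> (norm (disagreement (z 0))) t +
          \<gamma> (SUP s\<in>{0..t}. norm (u s)) + c"
        using bound [of J "\<lambda>t. disagreement (z t)" u t] t by blast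
      moreover have sup: "(SUP s\<in>{0..t}. norm (u s)) \<le> N * (\<sigma> + \<epsilon>)"
        by (rule cSUP_least) (use \<open>0 \<le> t\<close> sub u_le in auto)
      \<comment> \<open>\<open>\<gamma>\<close> is monotone only on \<open>{0..}\<close>, so the
        supremum must be shown to be non-negative.\<close>
      moreover have "norm (u 0) \<le> (SUP s\<in>{0..t}. norm (u s))"
        by (rule cSUP_upper) (use \<open>0 \<le> t\<close> sub u_le in \<open>auto intro!: bdd_aboveI\<close>)
      then have nonneg: "0 \<le> (SUP s\<in>{0..t}. norm (u s))"
        using norm_ge_zero order_trans by blast
      have "\<gamma> (SUP s\<in>{0..t}. norm (u s)) \<le> \<gamma> (N * (\<sigma> + \<epsilon>))"
        using \<gamma> sup nonneg
        by (intro mono_onD [of "{0..}" \<gamma>]) (auto simp: class_K_inf_def intro: strict_mono_on_imp_mono_on)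
      ultimately show "norm (disagreement (z t))
            \<le> \<beta> (norm (disagreement (z 0))) t + \<gamma> (N * (\<sigma> + \<epsilon>)) + \<bar>c\<bar>"
        by linarith
    qed
    \<comment> \<open>\<open>\<beta>\<close> decreases in time, so its value at time
      \<open>0\<close> makes the disagreement bound uniform on \<open>J\<close>.\<close>
    define X where "X = \<beta> (norm (disagreement (z 0))) 0 + \<gamma> (N * (\<sigma> + \<epsilon>)) + \<bar>c\<bar>"
    have "norm (z t) \<le> N * (Z + X)" if t: "t \<in> J" for t
      unfolding N_def
    proof (rule norm_vec_le_card)
      fix i
      have "0 \<le> t"
        using J t by (auto simp: time_domain_def)
      have "\<beta> (norm (disagreement (z 0))) t \<le> \<beta> (norm (disagreement (z 0))) 0"
        using \<beta> \<open>0 \<le> t\<close> by (auto simp: class_KL_def monotone_on_def)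
      moreover have "norm (disagreement (z t) $ i) \<le> norm (disagreement (z t))"
        by (rule Finite_Cartesian_Product.norm_nth_le)
      ultimately have "norm (disagreement (z t) $ i) \<le> X"
        using x_le t unfolding X_def by fastforce
      then have "norm (consensus (z t) + disagreement (z t) $ i) \<le> Z + X"
        using Z [OF t] by (intro norm_triangle_mono)
      then show "norm (z t $ i) \<le> Z + X"
        by (simp flip: consensus_plus_disagreement)
    qed
    then have "bounded (z ` J)"
      by (auto simp: bounded_iff)
    have "\<exists>d>0. \<forall>k. event_time (\<delta> i) J (g i) k + ereal d \<le> event_time (\<delta> i) J (g i) (Suc k)" for i
    proof -
      \<comment> \<open>Now that \<open>z\<close> is bounded on all of \<open>J\<close>, the horizon
        can be \<open>\<infinity>\<close> and one gap serves all events of agent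
        \<open>i\<close>.\<close>
      have "uniformly_continuous_on {t \<in> J. ereal t \<le> \<infinity>} (g i)"
        using g_uc [of J i] \<open>bounded (z ` J)\<close> by simp
      then obtain d where "d > 0"
        "\<And>k. min \<infinity> (event_time (\<delta> i) J (g i) k + ereal d) \<le> event_time (\<delta> i) J (g i) (Suc k)"
        using event_time_gap [where \<delta> = "\<delta> i", OF J \<delta>_ge \<open>\<epsilon> > 0\<close>, of \<infinity> "g i"] by blast
      then show ?thesis
        by (auto simp: min_absorb2 simp del: event_time.simps)
    qed
    then obtain d where d: "\<And>i. d i > 0"
      "\<And>i k. event_time (\<delta> i) J (g i) k + ereal (d i) \<le> event_time (\<delta> i) J (g i) (Suc k)"
      by metis
    define \<tau> where "\<tau> = Min (range d)"
    have "\<tau> > 0"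
      using d by (simp add: \<tau>_def)
    moreover have "event_time (\<delta> i) J (g i) k + ereal \<tau> \<le> event_time (\<delta> i) J (g i) (Suc k)" for i k
    proof -
      have "\<tau> \<le> d i"
        by (simp add: \<tau>_def)
      then have "event_time (\<delta> i) J (g i) k + ereal \<tau> \<le> event_time (\<delta> i) J (g i) k + ereal (d i)"
        by (intro add_left_mono) simp
      then show ?thesis
        using d(2) by (rule order_trans)
    qed
    ultimately show "\<exists>\<tau>>0. \<forall>i k. nn_etm_events m \<sigma> \<epsilon> \<eta> J z i k + ereal \<tau>
            \<le> nn_etm_events m \<sigma> \<epsilon> \<eta> J z i (Suc k)"
      unfolding events by blast
  qed
  have \<gamma>N: "class_K_inf (\<lambda>s. \<gamma> (N * s))"
    using \<gamma> \<open>N > 0\<close> by (rule class_K_inf_scale)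
  show ?thesis
  proof (intro exI [of _ \<beta>] exI [of _ "\<lambda>s. \<gamma> (N * s)"] exI [of _ "\<bar>c\<bar>"]
      conjI [OF \<beta>] conjI [OF \<gamma>N] conjI [OF abs_ge_zero] allI impI, goal_cases)
    case (1 \<sigma> \<epsilon> \<eta> J z)
    then obtain Z where "\<And>t. t \<in> J \<Longrightarrow> norm (consensus (z t)) \<le> Z"
      by meson
    with 1 show ?case
      by (intro main) auto
  qed
qed

end
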